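(* Let $\mathcal{T} = (P,Q,\epsilon_1,\epsilon_2)$ be a Pultr template such that the central Pultr functor $\Gamma_{\mathcal{T}}$ admits a right adjoint $\Omega_{\mathcal{T}}$, that is, there is a digraph functor $\Omega_{\mathcal{T}}$ such that for all digraphs $G,H$, $\Gamma_{\mathcal{T}}(G)\to H$ if and only if $G\to\Omega_{\mathcal{T}}(H)$. Then $P$ and $Q$ are each homomorphically equivalent to a tree. Moreover, for any tree $T$, the digraph $\Lambda_{\mathcal{T}}(T)$ is homomorphically equivalent to a tree.
   Context: A digraph $G$ is a finite vertex set $V(G)$ (possibly empty) with an arc set $A(G)\subseteq V(G)\times V(G)$ (loops allowed). A homomorphism is an arc-preserving map of vertices; $G\to H$ means that a homomorphism of $G$ to $H$ exists; $G$ and $H$ are homomorphically equivalent if $G\to H$ and $H\to G$. A tree is a digraph obtained by orienting each edge of a (nonempty, finite) undirected tree in exactly one direction. A digraph functor is a construction $\Gamma$ assigning a digraph $\Gamma(G)$ to every digraph $G$ such that $G\to H$ implies $\Gamma(G)\to\Gamma(H)$. A Pultr template is a quadruple $\mathcal{T}=(P,Q,\epsilon_1,\epsilon_2)$ where $P,Q$ are digraphs and $\epsilon_1,\epsilon_2$ are homomorphisms of $P$ to $Q$. Central Pultr functor: for a digraph $H$, the vertices of $\Gamma_{\mathcal{T}}(H)$ are the homomorphisms $g:P\to H$, and the arcs are the couples $(g_1,g_2)$ for which there exists a homomorphism $h:Q\to H$ with $g_1=h\circ\epsilon_1$ and $g_2=h\circ\epsilon_2$. Left Pultr functor: for a digraph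 $G$, $\Lambda_{\mathcal{T}}(G)$ is obtained from the disjoint union of one copy $P_u$ of $P$ for every vertex $u$ of $G$ and one copy $Q_{u,v}$ of $Q$ for every arc $(u,v)$ of $G$, by identifying, for every arc $(u,v)$ of $G$ and every vertex $x$ of $P$, the copy of $x$ in $P_u$ with the copy of $\epsilon_1(x)$ in $Q_{u,v}$, and the copy of $x$ in $P_v$ with the copy of $\epsilon_2(x)$ in $Q_{u,v}$ (that is, taking the quotient by the equivalence relation generated by these identifications, the arcs being the images of arcs). *)

theory Defs
  imports "Graph_Theory.Graph_Theory" "HOL-Library.FuncSet"
begin

text \<open>
  A (finite, possibly empty, loops allowed) digraph is a \<open>'a pair_pre_digraph\<close> satisfying
  \<^const>\<open>pair_fin_digraph\<close>. Homomorphisms are made extensional, so that a homomorphism is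
  determined by its values on vertices and homomorphisms from one digraph to another can be
  counted, and used as the vertices of another digraph.
\<close>

definition homs :: "'a pair_pre_digraph \<Rightarrow> 'b pair_pre_digraph \<Rightarrow> ('a \<Rightarrow> 'b) set" where
  "homs G H = {f \<in> pverts G \<rightarrow>\<^sub>E pverts H. \<forall>u v. (u, v) \<in> parcs G \<longrightarrow> (f u, f v) \<in> parcs H}"

definition hom_to :: "'a pair_pre_digraph \<Rightarrow> 'b pair_pre_digraph \<Rightarrow> bool" where
  "hom_to G H \<longleftrightarrow> (\<exists>f. f \<in> homs G H)"

definition hom_equivalent :: "'a pair_pre_digraph \<Rightarrow> 'b pair_pre_digraph \<Rightarrow> bool" where
  "hom_equivalent G H \<longleftrightarrow> hom_to G H \<and> hom_to H G"

text \<open>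
  An undirected graph is a symmetric loopfree digraph (\<^const>\<open>pair_graph\<close>). The library's
  \<open>cycle\<close> counts an edge walked back and forth as a cycle (so the library's \<open>tree\<close> is not the
  undirected notion); undirected cycles are those of length at least 3. The library's
  \<open>connected\<close> includes that there is at least one vertex.
\<close>

definition undirected_tree :: "'a pair_pre_digraph \<Rightarrow> bool" where
  "undirected_tree U \<longleftrightarrow>
     pair_graph U \<and> connected (with_proj U) \<and>
     \<not> (\<exists>p. pre_digraph.cycle (with_proj U) p \<and> 3 \<le> length p)"

definition oriented_tree :: "'a pair_pre_digraph \<Rightarrow> bool" where
  "oriented_tree T \<longleftrightarrow>
     (\<exists>U. undirected_tree U \<and> pverts T = pverts U \<and> parcs T \<subseteq> parcs U \<and>
          (\<forall>u v. (u, v) \<in> parcs U \<longrightarrow> ((u, v) \<in> parcs T \<longleftrightarrow> (v, u) \<notin> parcs T)))"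

text \<open>
  HOL cannot quantify over digraphs on all vertex types at once. As every digraph is isomorphic to
  one with vertices in \<^typ>\<open>nat\<close>, these represent all digraphs wherever ``all digraphs'' or
  ``some digraph'' is meant inside a definition.
\<close>

lemma digraph_nat_copy:
  assumes "pair_fin_digraph G"
  obtains N :: "nat pair_pre_digraph" and f where
    "pair_fin_digraph N" "bij_betw f (pverts G) (pverts N)" "parcs N = map_prod f f ` parcs G"
proof -
  interpret pair_fin_digraph G by fact
  obtain f :: "'a \<Rightarrow> nat" where f: "inj_on f (pverts G)"
    using finite_imp_inj_to_nat_seg[OF pair_finite_verts] by blast
  let ?N = "\<lparr>pverts = f ` pverts G, parcs = map_prod f f ` parcs G\<rparr>"
  have "pair_fin_digraph ?N"
    by unfold_locales (auto simp: in_arcsD1 in_arcsD2 pair_finite_verts pair_finite_arcs)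
  then show thesis
    by (rule that[of ?N f]) (use f in \<open>auto simp: bij_betw_def\<close>)
qed

definition hom_equivalent_to_tree :: "'a pair_pre_digraph \<Rightarrow> bool" where
  "hom_equivalent_to_tree G \<longleftrightarrow>
     (\<exists>T :: nat pair_pre_digraph. oriented_tree T \<and> hom_equivalent G T)"

definition digraph_functor :: "('a pair_pre_digraph \<Rightarrow> 'b pair_pre_digraph) \<Rightarrow> bool" where
  "digraph_functor F \<longleftrightarrow>
     (\<forall>G. pair_fin_digraph G \<longrightarrow> pair_fin_digraph (F G)) \<and>
     (\<forall>G H. pair_fin_digraph G \<longrightarrow> pair_fin_digraph H \<longrightarrow> hom_to G H \<longrightarrow> hom_to (F G) (F H))"

record ('p, 'q) pultr_template =
  tmpl_P :: "'p pair_pre_digraph"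
  tmpl_Q :: "'q pair_pre_digraph"
  tmpl_eps1 :: "'p \<Rightarrow> 'q"
  tmpl_eps2 :: "'p \<Rightarrow> 'q"

definition is_pultr_template :: "('p, 'q) pultr_template \<Rightarrow> bool" where
  "is_pultr_template \<T> \<longleftrightarrow>
     pair_fin_digraph (tmpl_P \<T>) \<and> pair_fin_digraph (tmpl_Q \<T>) \<and>
     tmpl_eps1 \<T> \<in> homs (tmpl_P \<T>) (tmpl_Q \<T>) \<and>
     tmpl_eps2 \<T> \<in> homs (tmpl_P \<T>) (tmpl_Q \<T>)"

definition central_pultr ::
  "('p, 'q) pultr_template \<Rightarrow> 'a pair_pre_digraph \<Rightarrow> ('p \<Rightarrow> 'a) pair_pre_digraph" where
  "central_pultr \<T> H =
     \<lparr>pverts = homs (tmpl_P \<T>) H,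
      parcs = {(compose (pverts (tmpl_P \<T>)) h (tmpl_eps1 \<T>),
                compose (pverts (tmpl_P \<T>)) h (tmpl_eps2 \<T>)) | h. h \<in> homs (tmpl_Q \<T>) H}\<rparr>"

text \<open>
  \<open>PCopy u x\<close> is the copy of \<open>x\<close> in \<open>P\<^sub>u\<close>, and \<open>QCopy u v y\<close> the copy of \<open>y\<close> in \<open>Q\<^sub>u\<^sub>,\<^sub>v\<close>.
\<close>

datatype ('a, 'p, 'q) pultr_vertex = PCopy 'a 'p | QCopy 'a 'a 'q

definition pultr_copies ::
  "('p, 'q) pultr_template \<Rightarrow> 'a pair_pre_digraph \<Rightarrow> ('a, 'p, 'q) pultr_vertex pair_pre_digraph" where
  "pultr_copies \<T> G =
     \<lparr>pverts = {PCopy u x | u x. u \<in> pverts G \<and> x \<in> pverts (tmpl_P \<T>)} \<union>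
               {QCopy u v y | u v y. (u, v) \<in> parcs G \<and> y \<in> pverts (tmpl_Q \<T>)},
      parcs = {(PCopy u x, PCopy u x') | u x x'. u \<in> pverts G \<and> (x, x') \<in> parcs (tmpl_P \<T>)} \<union>
              {(QCopy u v y, QCopy u v y') | u v y y'.
                 (u, v) \<in> parcs G \<and> (y, y') \<in> parcs (tmpl_Q \<T>)}\<rparr>"

definition pultr_identify ::
  "('p, 'q) pultr_template \<Rightarrow> 'a pair_pre_digraph \<Rightarrow> ('a, 'p, 'q) pultr_vertex rel" where
  "pultr_identify \<T> G =
     {(PCopy u x, QCopy u v (tmpl_eps1 \<T> x)) | u v x.
        (u, v) \<in> parcs G \<and> x \<in> pverts (tmpl_P \<T>)} \<union>
     {(PCopy v x, QCopy u v (tmpl_eps2 \<T> x)) | u v x.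
        (u, v) \<in> parcs G \<and> x \<in> pverts (tmpl_P \<T>)}"

text \<open>
  The equivalence relation generated by the identifications on the vertices of the disjoint union.
\<close>

definition pultr_equiv ::
  "('p, 'q) pultr_template \<Rightarrow> 'a pair_pre_digraph \<Rightarrow> ('a, 'p, 'q) pultr_vertex rel" where
  "pultr_equiv \<T> G =
     (pultr_identify \<T> G \<union> (pultr_identify \<T> G)\<inverse>)\<^sup>*
     \<inter> (pverts (pultr_copies \<T> G) \<times> pverts (pultr_copies \<T> G))"

definition left_pultr ::
  "('p, 'q) pultr_template \<Rightarrow> 'a pair_pre_digraph \<Rightarrow> ('a, 'p, 'q) pultr_vertex set pair_pre_digraph" where
  "left_pultr \<T> G =
     \<lparr>pverts = pverts (pultr_copies \<T> G) // pultr_equiv \<T> G,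
      parcs = {(pultr_equiv \<T> G `` {a}, pultr_equiv \<T> G `` {b}) | a b.
                 (a, b) \<in> parcs (pultr_copies \<T> G)}\<rparr>"

definition is_right_adjoint_of_central ::
  "('p, 'q) pultr_template \<Rightarrow> (nat pair_pre_digraph \<Rightarrow> nat pair_pre_digraph) \<Rightarrow> bool" where
  "is_right_adjoint_of_central \<T> \<Omega> \<longleftrightarrow>
     digraph_functor \<Omega> \<and>
     (\<forall>(G :: nat pair_pre_digraph) H. pair_fin_digraph G \<longrightarrow> pair_fin_digraph H \<longrightarrow>
        (hom_to (central_pultr \<T> G) H \<longleftrightarrow> hom_to G (\<Omega> H)))"

text \<open>Well-definedness of the two constructions.\<close>

lemma compose_homs:
  assumes "f \<in> homs A B" "g \<in> homs B C" "pair_fin_digraph A"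
  shows "compose (pverts A) g f \<in> homs A C"
proof -
  interpret A: pair_fin_digraph A by fact
  show ?thesis
    using assms(1,2) by (auto simp: homs_def compose_def A.in_arcsD1 A.in_arcsD2)
qed

lemma pair_fin_digraph_central_pultr:
  assumes "is_pultr_template \<T>" "pair_fin_digraph H"
  shows "pair_fin_digraph (central_pultr \<T> H)"
proof -
  interpret H: pair_fin_digraph H by fact
  interpret P: pair_fin_digraph "tmpl_P \<T>" using assms(1) by (simp add: is_pultr_template_def)
  let ?C = "central_pultr \<T> H"
  have sub: "parcs ?C \<subseteq> pverts ?C \<times> pverts ?C"
    using assms(1) compose_homs[OF _ _ P.pair_fin_digraph_axioms]
    by (auto simp: central_pultr_def is_pultr_template_def)
  have fin: "finite (pverts ?C)"
    by (rule finite_subset[of _ "pverts (tmpl_P \<T>) \<rightarrow>\<^sub>E pverts H"])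
       (auto simp: central_pultr_def homs_def
         intro: finite_PiE P.pair_finite_verts H.pair_finite_verts)
  show ?thesis
    by unfold_locales (use sub fin finite_subset[OF sub] in auto)
qed

lemma equiv_pultr_equiv: "equiv (pverts (pultr_copies \<T> G)) (pultr_equiv \<T> G)"
proof (rule equivI)
  show "refl_on (pverts (pultr_copies \<T> G)) (pultr_equiv \<T> G)"
    by (auto simp: refl_on_def pultr_equiv_def)
  show "sym (pultr_equiv \<T> G)"
    unfolding pultr_equiv_def
    by (rule sym_Int) (auto intro: sym_rtrancl sym_Un_converse simp: sym_def[of "_ \<times> _"])
  show "trans (pultr_equiv \<T> G)"
    unfolding pultr_equiv_def
    by (rule trans_Int) (auto intro: trans_rtrancl simp: trans_def[of "_ \<times> _"])
qed (auto simp: pultr_equiv_def)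

lemma pair_fin_digraph_left_pultr:
  assumes "is_pultr_template \<T>" "pair_fin_digraph G"
  shows "pair_fin_digraph (left_pultr \<T> G)"
proof -
  interpret G: pair_fin_digraph G by fact
  interpret P: pair_fin_digraph "tmpl_P \<T>" using assms(1) by (simp add: is_pultr_template_def)
  interpret Q: pair_fin_digraph "tmpl_Q \<T>" using assms(1) by (simp add: is_pultr_template_def)
  let ?D = "pultr_copies \<T> G" and ?L = "left_pultr \<T> G"
  have "pverts ?D = (\<lambda>(u, x). PCopy u x) ` (pverts G \<times> pverts (tmpl_P \<T>)) \<union>
      (\<lambda>((u, v), y). QCopy u v y) ` (parcs G \<times> pverts (tmpl_Q \<T>))"
    by (force simp: pultr_copies_def)
  then have finD: "finite (pverts ?D)"
    by (simp add: G.pair_finite_verts G.pair_finite_arcs P.pair_finite_verts Q.pair_finite_verts)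
  have fin: "finite (pverts ?L)"
    using finD by (auto simp: left_pultr_def pultr_equiv_def intro!: finite_quotient)
  have "parcs ?D \<subseteq> pverts ?D \<times> pverts ?D"
    by (auto simp: pultr_copies_def P.in_arcsD1 P.in_arcsD2 Q.in_arcsD1 Q.in_arcsD2)
  then have sub: "parcs ?L \<subseteq> pverts ?L \<times> pverts ?L"
    by (auto simp: left_pultr_def intro!: quotientI)
  show ?thesis
    by unfold_locales (use sub fin finite_subset[OF sub] in auto)
qed

end

theory Submission
  imports Defs
begin

text \<open>
  Call \<open>D\<close> a dual of \<open>T\<close> if for all \<open>G\<close>, \<open>T \<rightarrow> G\<close> iff not \<open>G \<rightarrow> D\<close>. Every tree has a dual, and
  conversely a digraph with a dual is homomorphically equivalent to a tree. If \<open>D\<close> is a dual of the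
  tree \<open>T\<close>, then \<open>\<Lambda>(T) \<rightarrow> G\<close> iff \<open>T \<rightarrow> \<Gamma>(G)\<close> iff not \<open>\<Gamma>(G) \<rightarrow> D\<close> iff not \<open>G \<rightarrow> \<Omega>(D)\<close>, so \<open>\<Lambda>(T)\<close> has
  the dual \<open>\<Omega>(D)\<close>. Up to isomorphism, \<open>P\<close> and \<open>Q\<close> are \<open>\<Lambda>\<close> of a vertex and of an arc, whose duals are
  the empty digraph and a vertex without arcs.

  For the converse, take \<open>C\<close> minimal in the class of a digraph with dual \<open>D\<close>. It is connected, as
  otherwise a component that does not map to \<open>D\<close> would be equivalent to \<open>C\<close>. Given an arc \<open>(a, b)\<close>,
  let \<open>U\<close> consist of many copies of \<open>C - (a, b)\<close> with arcs from the \<open>i\<close>-th copy of \<open>a\<close> to the \<open>j\<close>-th copy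
  of \<open>b\<close> for \<open>i < j\<close>. By the pigeonhole principle \<open>U\<close> does not map to \<open>D\<close>, so \<open>C \<rightarrow> U\<close>, and by minimality
  there is a section of the projection of \<open>U\<close> to \<open>C\<close>. As it cannot return to the copy of \<open>a\<close> after crossing
  to the copy of \<open>b\<close>, the arc \<open>(a, b)\<close> is a bridge.
\<close>

section \<open>Trees as connected digraphs whose arcs are bridges\<close>

abbreviation linked :: "'a rel \<Rightarrow> 'a rel" where
  "linked A \<equiv> (A \<union> A\<inverse>)\<^sup>*"

lemma linked_sym: "(u, v) \<in> linked A \<Longrightarrow> (v, u) \<in> linked A"
  by (metis sym_Un_converse sym_rtrancl symD)

lemma linked_mono: "A \<subseteq> B \<Longrightarrow> (u, v) \<in> linked A \<Longrightarrow> (u, v) \<in> linked B"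
  by (meson Un_mono converse_mono rtrancl_mono subsetD)

lemma pcas_rtrancl: "pcas u p v \<Longrightarrow> set p \<subseteq> R \<Longrightarrow> (u, v) \<in> R\<^sup>*"
  by (induction p arbitrary: u) (auto intro: converse_rtrancl_into_rtrancl)

lemma in_pawalk_verts: "e \<in> set p \<Longrightarrow> fst e \<in> set (pawalk_verts u p)"
  by (induction p arbitrary: u) auto

lemma end_in_pawalk_verts: "pcas u p v \<Longrightarrow> v \<in> set (pawalk_verts u p)"
  by (induction p arbitrary: u) auto

text \<open>The end \<open>v\<close> is the last entry of the vertex list, and the tail of each arc
  stands at an earlier position, so distinctness separates them.\<close>

lemma fst_neq_end_of_path:
  "pcas u p v \<Longrightarrow> distinct (pawalk_verts u p) \<Longrightarrow> e \<in> set p \<Longrightarrow> fst e \<noteq> v"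
  by (induction p arbitrary: u) (auto dest: end_in_pawalk_verts)

lemma connected_iff_linked:
  assumes "pair_wf_digraph U"
  shows "connected (with_proj U) \<longleftrightarrow>
    pverts U \<noteq> {} \<and> (\<forall>u\<in>pverts U. \<forall>v\<in>pverts U. (u, v) \<in> linked (parcs U))"
proof -
  interpret U: pair_wf_digraph U by fact
  interpret S: pair_wf_digraph "mk_symmetric (with_proj U)" ..
  have eq: "parcs (mk_symmetric (with_proj U)) = parcs U \<union> (parcs U)\<inverse>"
    by (auto simp: parcs_mk_symmetric)
  have "(u \<rightarrow>\<^sup>*\<^bsub>with_proj (mk_symmetric (with_proj U))\<^esub> v) = ((u, v) \<in> linked (parcs U))"
    if "u \<in> pverts U" for u v
    using S.reachable_conv'[of u v] that by (simp add: eq)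
  then show ?thesis
    by (auto simp: connected_def strongly_connected_def)
qed

text \<open>An undirected cycle through an edge amounts to a path joining its ends without that
  edge. The bridge condition also excludes loops and pairs of opposite arcs, so each edge gets
  exactly one direction.\<close>

lemma oriented_tree_iff:
  "oriented_tree T \<longleftrightarrow> pair_fin_digraph T \<and> pverts T \<noteq> {} \<and>
     (\<forall>u\<in>pverts T. \<forall>v\<in>pverts T. (u, v) \<in> linked (parcs T)) \<and>
     (\<forall>u v. (u, v) \<in> parcs T \<longrightarrow> (u, v) \<notin> linked (parcs T - {(u, v)}))"
proof
  assume "oriented_tree T"
  then obtain U where U: "undirected_tree U" "pverts T = pverts U" "parcs T \<subseteq> parcs U"
    and orient: "\<And>u v. (u, v) \<in> parcs U \<Longrightarrow> (u, v) \<in> parcs T \<longleftrightarrow> (v, u) \<notin> parcs T"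
    unfolding oriented_tree_def by blast
  interpret U: pair_graph U using U(1) by (simp add: undirected_tree_def)
  have sym: "(v, u) \<in> parcs U" if "(u, v) \<in> parcs U" for u v
    using that U.sym_arcs by (auto simp: symmetric_def dest: symD)
  have eq: "parcs U = parcs T \<union> (parcs T)\<inverse>"
  proof (intro equalityI subrelI)
    fix u v assume "(u, v) \<in> parcs U"
    then show "(u, v) \<in> parcs T \<union> (parcs T)\<inverse>"
      using orient by blast
  qed (use U(3) sym in blast)
  have fin: "pair_fin_digraph T"
    using U U.pair_finite_verts U.pair_finite_arcs U.in_arcsD1 U.in_arcsD2
    by unfold_locales (auto intro: finite_subset)
  have con: "pverts U \<noteq> {}" "\<forall>u\<in>pverts U. \<forall>v\<in>pverts U. (u, v) \<in> linked (parcs U)"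
    using U(1) connected_iff_linked[OF U.pair_wf_digraph_axioms]
    by (auto simp: undirected_tree_def)
  have "parcs U \<union> (parcs U)\<inverse> = parcs T \<union> (parcs T)\<inverse>"
    by (auto simp: eq)
  then have con': "\<forall>u\<in>pverts T. \<forall>v\<in>pverts T. (u, v) \<in> linked (parcs T)"
    using con U(2) by simp
  have "(u, v) \<notin> linked (parcs T - {(u, v)})" if e: "(u, v) \<in> parcs T" for u v
  proof
    assume l: "(u, v) \<in> linked (parcs T - {(u, v)})"
    let ?B = "(parcs T - {(u, v)}) \<union> (parcs T - {(u, v)})\<inverse>"
    \<comment> \<open>\<open>W\<close> is the undirected graph without the edge between
      \<open>u\<close> and \<open>v\<close>. A simple path in it from \<open>u\<close> to
      \<open>v\<close>, closed by \<open>(v, u)\<close>, is the forbidden cycle.\<close>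
    define W where "W = \<lparr>pverts = pverts U, parcs = ?B\<rparr>"
    have uv: "u \<in> pverts U" "v \<in> pverts U" "(v, u) \<in> parcs U" "u \<noteq> v" "(v, u) \<notin> parcs T"
      using e U(3) U.in_arcsD1 U.in_arcsD2 sym U.pair_no_loops orient by (blast | force)+
    have "?B \<subseteq> parcs U" using eq by auto
    then interpret W: pair_wf_digraph W
      using U.in_arcsD1 U.in_arcsD2 by unfold_locales (auto simp: W_def)
    have "u \<rightarrow>\<^sup>*\<^bsub>with_proj W\<^esub> v"
      using W.reachable_conv'[of u v] l uv(1) by (simp add: W_def)
    then obtain p where p: "W.apath u p v"
      using W.reachable_apath by blast
    then have "set p \<subseteq> parcs W" and p': "pcas u p v" "distinct (pawalk_verts u p)"
      by (auto simp: W.apath_def W.awalk_def)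
    then have sub: "set p \<subseteq> ?B" by (simp add: W_def)
    have "p \<noteq> []" using p'(1) uv(4) by auto
    \<comment> \<open>A path of one arc would be \<open>[(u, v)]\<close>, which lies in
      \<open>?B\<close> only if \<open>(v, u)\<close> is an arc of \<open>T\<close>. Excluding it
      gives the length of at least 3.\<close>
    moreover have "p \<noteq> [x]" for x
      using p'(1) sub uv(5) by (cases x) auto
    ultimately have len: "3 \<le> length ((v, u) # p)"
      by (cases p; cases "tl p") auto
    have "U.cycle ((v, u) # p)"
      unfolding U.cycle_def U.awalk_def
      using p' sub uv \<open>?B \<subseteq> parcs U\<close> by (intro exI[of _ v]) auto
    then show False
      using U(1) len by (auto simp: undirected_tree_def)
  qed
  then show "pair_fin_digraph T \<and> pverts T \<noteq> {} \<and>
     (\<forall>u\<in>pverts T. \<forall>v\<in>pverts T. (u, v) \<in> linked (parcs T)) \<and>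
     (\<forall>u v. (u, v) \<in> parcs T \<longrightarrow> (u, v) \<notin> linked (parcs T - {(u, v)}))"
    using fin con con' U(2) by auto
next
  assume T: "pair_fin_digraph T \<and> pverts T \<noteq> {} \<and>
     (\<forall>u\<in>pverts T. \<forall>v\<in>pverts T. (u, v) \<in> linked (parcs T)) \<and>
     (\<forall>u v. (u, v) \<in> parcs T \<longrightarrow> (u, v) \<notin> linked (parcs T - {(u, v)}))"
  then interpret T: pair_fin_digraph T by blast
  have bridge: "(u, v) \<notin> linked (parcs T - {(u, v)})" if "(u, v) \<in> parcs T" for u v
    using T that by blast
  \<comment> \<open>A cycle may traverse an edge against its orientation, so the bridge property is
    restated for both directions, with the whole edge removed.\<close>
  have bridge': "(u, v) \<notin> linked (parcs T - {(u, v), (v, u)})"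
    if "(u, v) \<in> parcs T \<union> (parcs T)\<inverse>" for u v
  proof -
    have "(u, v) \<notin> linked (parcs T - {(u, v)}) \<or> (u, v) \<notin> linked (parcs T - {(v, u)})"
      using that bridge linked_sym by fastforce
    moreover have "parcs T - {(u, v), (v, u)} \<subseteq> parcs T - {(u, v)}"
      "parcs T - {(u, v), (v, u)} \<subseteq> parcs T - {(v, u)}" by auto
    ultimately show ?thesis using linked_mono by metis
  qed
  define U where "U = \<lparr>pverts = pverts T, parcs = parcs T \<union> (parcs T)\<inverse>\<rparr>"
  interpret U: pair_graph U
  proof unfold_locales
    show "symmetric (with_proj U)" by (auto simp: symmetric_def U_def intro: symI)
    show "fst e \<noteq> snd e" if "e \<in> parcs U" for e
      using that bridge' by (cases e) (auto simp: U_def)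
  qed (auto simp: U_def T.in_arcsD1 T.in_arcsD2 T.pair_finite_verts T.pair_finite_arcs)
  have "linked (parcs U) = linked (parcs T)"
    by (rule arg_cong[of _ _ rtrancl]) (auto simp: U_def)
  then have con: "connected (with_proj U)"
    using T connected_iff_linked[OF U.pair_wf_digraph_axioms] by (auto simp: U_def)
  have "\<not> U.cycle p" if len: "3 \<le> length p" for p
  proof
    assume "U.cycle p"
    then obtain a where a: "set p \<subseteq> parcs U" "pcas a p a" "distinct (tl (pawalk_verts a p))"
      by (auto simp: U.cycle_def U.awalk_def)
    \<comment> \<open>The cycle is its first arc \<open>(a, b)\<close> followed by a path from
      \<open>b\<close> back to \<open>a\<close>. As \<open>q\<close> is nonempty,
      \<open>c \<noteq> a\<close>, so the path does not start by reversing \<open>(a, b)\<close>;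
      distinctness excludes that edge later on.\<close>
    obtain b c q where p: "p = (a, b) # (b, c) # q" and q: "q \<noteq> []"
      using len a(2) by (cases p; cases "tl p") fastforce+
    have d: "distinct (pawalk_verts b ((b, c) # q))" "pcas b ((b, c) # q) a" "pcas c q a"
      using a p by auto
    have "c \<noteq> a" using d q fst_neq_end_of_path[of c q a "hd q"] by (cases q) auto
    moreover have "fst e \<noteq> a" if "e \<in> set ((b, c) # q)" for e
      using fst_neq_end_of_path[OF d(2,1) that] .
    moreover have "fst e \<noteq> b" if "e \<in> set q" for e
      using d(1) in_pawalk_verts[OF that, of c] by auto
    ultimately have "(a, b) \<notin> set ((b, c) # q)" "(b, a) \<notin> set ((b, c) # q)"
      by force+
    then have "set ((b, c) # q) \<subseteq>
        (parcs T - {(a, b), (b, a)}) \<union> (parcs T - {(a, b), (b, a)})\<inverse>"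
      using a(1) unfolding p U_def by auto
    then have "(b, a) \<in> linked (parcs T - {(a, b), (b, a)})"
      using pcas_rtrancl d(2) by metis
    then show False
      using bridge'[of a b] linked_sym a(1) by (fastforce simp: p U_def)
  qed
  moreover have "(v, u) \<notin> parcs T" if "(u, v) \<in> parcs T" for u v
  proof
    assume vu: "(v, u) \<in> parcs T"
    have "u \<noteq> v" using bridge that by auto
    then have "(u, v) \<in> linked (parcs T - {(u, v)})"
      using vu by (intro r_into_rtrancl) auto
    then show False using bridge that by blast
  qed
  ultimately show "oriented_tree T"
    unfolding oriented_tree_def undirected_tree_def
    by (intro exI[of _ U]) (use con U.pair_graph_axioms in \<open>auto simp: U_def\<close>)
qed

section \<open>Homomorphisms and duals\<close>

text \<open>Unlike the elements of \<^const>\<open>homs\<close>, these maps may take any value outside the domain.\<close>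

definition is_hom :: "('a \<Rightarrow> 'b) \<Rightarrow> 'a pair_pre_digraph \<Rightarrow> 'b pair_pre_digraph \<Rightarrow> bool" where
  "is_hom f G H \<longleftrightarrow> (\<forall>u\<in>pverts G. f u \<in> pverts H) \<and>
     (\<forall>u v. (u, v) \<in> parcs G \<longrightarrow> (f u, f v) \<in> parcs H)"

lemma is_hom_comp: "is_hom f G H \<Longrightarrow> is_hom g H K \<Longrightarrow> is_hom (g \<circ> f) G K"
  by (simp add: is_hom_def)

lemma is_hom_if_homs: "f \<in> homs G H \<Longrightarrow> is_hom f G H"
  by (auto simp: is_hom_def homs_def)

lemma restrict_homs:
  assumes "is_hom f G H" "pair_fin_digraph G"
  shows "restrict f (pverts G) \<in> homs G H"
proof -
  interpret G: pair_fin_digraph G by fact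
  show ?thesis using assms(1) G.in_arcsD1 G.in_arcsD2 by (auto simp: is_hom_def homs_def)
qed

lemma hom_to_iff: "pair_fin_digraph G \<Longrightarrow> hom_to G H \<longleftrightarrow> (\<exists>f. is_hom f G H)"
  using is_hom_if_homs restrict_homs by (metis hom_to_def)

lemma hom_to_trans: "pair_fin_digraph G \<Longrightarrow> hom_to G H \<Longrightarrow> hom_to H K \<Longrightarrow> hom_to G K"
  using is_hom_comp is_hom_if_homs hom_to_iff by (metis hom_to_def)

lemma hom_to_refl: "pair_fin_digraph G \<Longrightarrow> hom_to G G"
  by (auto simp: hom_to_iff is_hom_def intro: exI[of _ id])

text \<open>The isomorphic copy as a pair of homomorphisms, which is the form used to reduce an
  arbitrary vertex type to \<open>nat\<close>.\<close>

lemma nat_copy: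
  assumes "pair_fin_digraph G"
  obtains N :: "nat pair_pre_digraph" and f g where
    "pair_fin_digraph N" "is_hom f G N" "is_hom g N G" "\<And>x. x \<in> pverts G \<Longrightarrow> g (f x) = x"
proof -
  interpret G: pair_fin_digraph G by fact
  obtain N :: "nat pair_pre_digraph" and f where N: "pair_fin_digraph N"
    "bij_betw f (pverts G) (pverts N)" "parcs N = map_prod f f ` parcs G"
    using digraph_nat_copy[OF assms] by blast
  have inv: "inv_into (pverts G) f (f x) = x" if "x \<in> pverts G" for x
    using that N(2) by (simp add: bij_betw_def)
  have into: "inv_into (pverts G) f x \<in> pverts G" if "x \<in> pverts N" for x
    using that N(2) inv_into_into[of x f "pverts G"] by (simp add: bij_betw_def)
  show thesis
  proof (rule that[OF N(1)])
    show "is_hom f G N" using N by (force simp: is_hom_def bij_betw_def)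
    show "is_hom (inv_into (pverts G) f) N G"
      using N(3) inv into by (auto simp: is_hom_def G.in_arcsD1 G.in_arcsD2)
  qed (fact inv)
qed

definition dual_pair :: "'a pair_pre_digraph \<Rightarrow> 'b pair_pre_digraph \<Rightarrow> bool" where
  "dual_pair P D \<longleftrightarrow>
     (\<forall>G :: nat pair_pre_digraph. pair_fin_digraph G \<longrightarrow> (hom_to P G \<longleftrightarrow> \<not> hom_to G D))"

text \<open>A test digraph on any vertex type is homomorphically equivalent to its copy on
  \<open>nat\<close>.\<close>

lemma dual_pairD:
  fixes G :: "'c pair_pre_digraph"
  assumes "dual_pair P D" "pair_fin_digraph P" "pair_fin_digraph G"
  shows "hom_to P G \<longleftrightarrow> \<not> hom_to G D"
proof -
  obtain N :: "nat pair_pre_digraph" and f g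
    where N: "pair_fin_digraph N" "is_hom f G N" "is_hom g N G"
    using nat_copy[OF assms(3)] by metis
  have "hom_to G N" "hom_to N G" using N assms(3) by (auto simp: hom_to_iff)
  then show ?thesis
    using assms N(1) hom_to_trans unfolding dual_pair_def by metis
qed

lemma dual_pair_cong:
  assumes "dual_pair P D" "pair_fin_digraph P" "pair_fin_digraph C" "hom_equivalent P C"
  shows "dual_pair C D"
  using assms hom_to_trans unfolding dual_pair_def hom_equivalent_def by metis

section \<open>The dual of a tree\<close>

definition oriented :: "bool \<Rightarrow> 'a \<Rightarrow> 'a \<Rightarrow> 'a \<times> 'a" where
  "oriented b u v = (if b then (u, v) else (v, u))"

text \<open>This form of trees makes rule induction remove a leaf. The flag \<open>b\<close> covers
  both directions of the new arc.\<close>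

inductive grown_tree :: "'a set \<Rightarrow> 'a rel \<Rightarrow> bool" where
  root: "grown_tree {r} {}"
| leaf: "grown_tree V A \<Longrightarrow> u \<in> V \<Longrightarrow> w \<notin> V \<Longrightarrow>
    grown_tree (insert w V) (insert (oriented b u w) A)"

lemma grown_tree_arcs: "grown_tree V A \<Longrightarrow> A \<subseteq> V \<times> V"
  by (induction rule: grown_tree.induct) (auto simp: oriented_def)

lemma linked_insert:
  assumes "(r, u) \<in> linked A"
  shows "(r, w) \<in> linked (insert (oriented b u w) A)"
proof -
  have "(r, u) \<in> linked (insert (oriented b u w) A)"
    using linked_mono[OF _ assms] by blast
  moreover have "(u, w) \<in> insert (oriented b u w) A \<union> (insert (oriented b u w) A)\<inverse>"
    by (simp add: oriented_def)
  ultimately show ?thesis by (rule rtrancl_into_rtrancl)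
qed

lemma grown_tree_linked:
  assumes "grown_tree V A" "a \<in> V" "b \<in> V"
  shows "(a, b) \<in> linked A"
proof -
  have "\<exists>r\<in>V. \<forall>a\<in>V. (r, a) \<in> linked A"
    using assms(1)
  proof (induction rule: grown_tree.induct)
    case (leaf V A u w b)
    then obtain r where "r \<in> V" "\<forall>a\<in>V. (r, a) \<in> linked A" by blast
    then show ?case
      using leaf.hyps linked_insert[of r u A w b] linked_mono[of A "insert (oriented b u w) A"]
      by blast
  qed auto
  then show ?thesis
    using assms(2,3) linked_sym rtrancl_trans by metis
qed

lemma linked_crossing:
  assumes "(a, b) \<in> linked A" "a \<in> V" "b \<notin> V"
  obtains u w i where "u \<in> V" "w \<notin> V" "oriented i u w \<in> A"
proof -
  have "b \<in> V \<or> (\<exists>u w. u \<in> V \<and> w \<notin> V \<and> ((u, w) \<in> A \<or> (w, u) \<in> A))"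
    using assms(1) by (induction rule: rtrancl_induct) (use assms(2) in auto)
  then show thesis
    using that[of _ _ True] that[of _ _ False] assms(3) by (auto simp: oriented_def)
qed

text \<open>Take a grown subtree with the most vertices. If it missed a vertex, connectedness would
  give an arc leaving it, hence a further leaf. An arc of \<open>T\<close> outside it would not be a
  bridge, as the subtree already links its ends.\<close>

lemma grown_tree_if_oriented_tree:
  assumes "oriented_tree T"
  shows "grown_tree (pverts T) (parcs T)"
proof -
  have T: "pair_fin_digraph T" "pverts T \<noteq> {}"
    "\<And>u v. u \<in> pverts T \<Longrightarrow> v \<in> pverts T \<Longrightarrow> (u, v) \<in> linked (parcs T)"
    "\<And>u v. (u, v) \<in> parcs T \<Longrightarrow> (u, v) \<notin> linked (parcs T - {(u, v)})"
    using assms[unfolded oriented_tree_iff] by blast+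
  interpret T: pair_fin_digraph T by fact
  define good where "good = (\<lambda>(V, A). grown_tree V A \<and> V \<subseteq> pverts T \<and> A \<subseteq> parcs T)"
  obtain r where "r \<in> pverts T" using T(2) by blast
  then have "good ({r}, {})" by (auto simp: good_def intro: root)
  moreover have "\<forall>x. good x \<longrightarrow> card (fst x) < Suc (card (pverts T))"
    by (auto simp: good_def less_Suc_eq_le intro!: card_mono T.pair_finite_verts)
  ultimately obtain x where x: "good x" "\<And>y. good y \<Longrightarrow> card (fst y) \<le> card (fst x)"
    using ex_has_greatest_nat[of good "({r}, {})" "\<lambda>x. card (fst x)"] by blast
  obtain V A where [simp]: "x = (V, A)" by fastforce
  have VA: "grown_tree V A" "V \<subseteq> pverts T" "A \<subseteq> parcs T" using x(1) by (auto simp: good_def)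
  have "finite V" using VA(2) T.pair_finite_verts finite_subset by blast
  have "V \<noteq> {}" using VA(1) by cases auto
  have V: "V = pverts T"
  proof (rule ccontr)
    assume "V \<noteq> pverts T"
    then obtain a b where ab: "a \<in> V" "b \<in> pverts T" "b \<notin> V"
      using VA(2) \<open>V \<noteq> {}\<close> by blast
    then have "(a, b) \<in> linked (parcs T)" using T(3) VA(2) by blast
    then obtain u w i where uw: "u \<in> V" "w \<notin> V" "oriented i u w \<in> parcs T"
      using linked_crossing ab by metis
    then have "w \<in> pverts T"
      using T.in_arcsD1 T.in_arcsD2 by (auto simp: oriented_def split: if_splits)
    then have "good (insert w V, insert (oriented i u w) A)"
      using VA uw by (auto simp: good_def intro: leaf)
    then show False using x(2) uw(2) \<open>finite V\<close> by fastforce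
  qed
  have "parcs T \<subseteq> A"
  proof (rule subrelI, rule ccontr)
    fix u v assume uv: "(u, v) \<in> parcs T" "(u, v) \<notin> A"
    have "(u, v) \<in> linked A"
      using grown_tree_linked[OF VA(1)] uv(1) T.in_arcsD1 T.in_arcsD2 V by simp
    then show False using T(4)[OF uv(1)] linked_mono[of A "parcs T - {(u, v)}"] VA(3) uv(2) by blast
  qed
  then have "A = parcs T" using VA(3) by blast
  then show ?thesis using VA(1) V by simp
qed

text \<open>
  The point of this notion: no vertex of \<open>G\<close> satisfies \<open>X G\<close> iff \<open>G\<close> maps to \<open>D - S\<close>.
\<close>

definition separates ::
  "'b pair_pre_digraph \<Rightarrow> 'b set \<Rightarrow> (nat pair_pre_digraph \<Rightarrow> nat \<Rightarrow> bool) \<Rightarrow> bool" where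
  "separates D S X \<longleftrightarrow> pair_fin_digraph D \<and> (\<forall>G. pair_fin_digraph G \<longrightarrow>
     (\<forall>f. is_hom f G D \<longrightarrow> (\<forall>x\<in>pverts G. X G x \<longrightarrow> f x \<in> S)) \<and>
     (\<exists>c. is_hom c G D \<and> (\<forall>x\<in>pverts G. c x \<in> S \<longrightarrow> X G x)))"

definition separable :: "(nat pair_pre_digraph \<Rightarrow> nat \<Rightarrow> bool) \<Rightarrow> bool" where
  "separable X \<longleftrightarrow> (\<exists>(D :: nat pair_pre_digraph) S. separates D S X)"

lemma separatesI:
  assumes "pair_fin_digraph D"
    and "\<And>G f x. pair_fin_digraph G \<Longrightarrow> is_hom f G D \<Longrightarrow> x \<in> pverts G \<Longrightarrow> X G x \<Longrightarrow> f x \<in> S"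
    and "\<And>G. pair_fin_digraph G \<Longrightarrow> \<exists>c. is_hom c G D \<and> (\<forall>x\<in>pverts G. c x \<in> S \<longrightarrow> X G x)"
  shows "separates D S X"
  using assms unfolding separates_def by blast

lemma separatesD:
  assumes "separates D S X" "pair_fin_digraph G" "is_hom f G D" "x \<in> pverts G" "X G x"
  shows "f x \<in> S"
  using assms unfolding separates_def by blast

text \<open>The constructions below use products and the unit type. The witness is moved to a copy
  on \<open>nat\<close>, with \<open>S\<close> pulled back along the isomorphism.\<close>

lemma separableI:
  fixes D :: "'b pair_pre_digraph"
  assumes "separates D S X"
  shows "separable X"
proof -
  have D: "pair_fin_digraph D" using assms by (simp add: separates_def)
  obtain N :: "nat pair_pre_digraph" and f g where N: "pair_fin_digraph N"
    "is_hom f D N" "is_hom g N D" "\<And>x. x \<in> pverts D \<Longrightarrow> g (f x) = x"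
    using nat_copy[OF D] by metis
  have "separates N {n. g n \<in> S} X"
  proof (rule separatesI[OF N(1)])
    fix G :: "nat pair_pre_digraph" and h x
    assume *: "pair_fin_digraph G" "is_hom h G N" "x \<in> pverts G" "X G x"
    then have "(g \<circ> h) x \<in> S"
      using separatesD[OF assms] is_hom_comp[OF *(2) N(3)] by blast
    then show "h x \<in> {n. g n \<in> S}" by simp
  next
    fix G :: "nat pair_pre_digraph" assume "pair_fin_digraph G"
    then obtain c where c: "is_hom c G D" "\<forall>x\<in>pverts G. c x \<in> S \<longrightarrow> X G x"
      using assms by (auto simp: separates_def)
    then show "\<exists>c. is_hom c G N \<and> (\<forall>x\<in>pverts G. c x \<in> {n. g n \<in> S} \<longrightarrow> X G x)"
      using is_hom_comp[OF c(1) N(2)] N(4)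
      by (intro exI[of _ "f \<circ> c"]) (auto simp: is_hom_def)
  qed
  then show ?thesis by (auto simp: separable_def)
qed

lemma separable_True: "separable (\<lambda>G x. True)"
proof (rule separableI, rule separatesI)
  let ?D = "\<lparr>pverts = {()}, parcs = {((), ())}\<rparr>"
  show "pair_fin_digraph ?D" by unfold_locales auto
  show "f x \<in> UNIV" for f :: "nat \<Rightarrow> unit" and x by simp
  show "\<exists>c. is_hom c G ?D \<and> (\<forall>x\<in>pverts G. c x \<in> UNIV \<longrightarrow> True)" for G :: "nat pair_pre_digraph"
    by (auto simp: is_hom_def)
qed

text \<open>A homomorphism to the product digraph is a pair of homomorphisms, and
  \<open>S \<times> T\<close> tests both components.\<close>

lemma separable_conj:
  assumes "separable X" "separable Y"
  shows "separable (\<lambda>G x. X G x \<and> Y G x)"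
proof -
  obtain D E :: "nat pair_pre_digraph" and S T
    where D: "separates D S X" and E: "separates E T Y"
    using assms unfolding separable_def by blast
  interpret D: pair_fin_digraph D using D by (simp add: separates_def)
  interpret E: pair_fin_digraph E using E by (simp add: separates_def)
  define F where "F = \<lparr>pverts = pverts D \<times> pverts E,
    parcs = {((d, e), (d', e')). (d, d') \<in> parcs D \<and> (e, e') \<in> parcs E}\<rparr>"
  have sub: "parcs F \<subseteq> pverts F \<times> pverts F" and fin: "finite (pverts F)"
    using D.pair_finite_verts E.pair_finite_verts
    by (auto simp: F_def D.in_arcsD1 E.in_arcsD1 D.in_arcsD2 E.in_arcsD2)
  have hom: "is_hom fst F D" "is_hom snd F E" by (auto simp: is_hom_def F_def)
  show ?thesis
  proof (rule separableI, rule separatesI)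
    show "pair_fin_digraph F"
      by unfold_locales (use sub fin finite_subset[OF sub] in auto)
    show "f x \<in> S \<times> T"
      if "pair_fin_digraph G" "is_hom f G F" "x \<in> pverts G" "X G x \<and> Y G x" for f G x
      using that separatesD[OF D _ is_hom_comp[OF that(2) hom(1)]]
        separatesD[OF E _ is_hom_comp[OF that(2) hom(2)]]
      by (auto simp: mem_Times_iff)
    show "\<exists>c. is_hom c G F \<and> (\<forall>x\<in>pverts G. c x \<in> S \<times> T \<longrightarrow> X G x \<and> Y G x)"
      if G: "pair_fin_digraph G" for G :: "nat pair_pre_digraph"
    proof -
      obtain c d where "is_hom c G D" "\<forall>x\<in>pverts G. c x \<in> S \<longrightarrow> X G x"
        "is_hom d G E" "\<forall>x\<in>pverts G. d x \<in> T \<longrightarrow> Y G x"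
        using D E G unfolding separates_def by blast
      then show ?thesis
        by (intro exI[of _ "\<lambda>x. (c x, d x)"]) (auto simp: is_hom_def F_def)
    qed
  qed
qed

text \<open>Each vertex of \<open>D\<close> gets a flag claiming that a suitable neighbour exists.
  The arcs force the flag at a vertex whose neighbour lies over \<open>S\<close>. Conversely the
  flag can be set to the truth, because the map \<open>c\<close> enters \<open>S\<close> only at
  vertices satisfying \<open>X\<close>.\<close>

lemma separable_neighbour:
  assumes "separable X"
  shows "separable (\<lambda>G x. \<exists>y. oriented b x y \<in> parcs G \<and> X G y)"
proof -
  obtain D :: "nat pair_pre_digraph" and S where D: "separates D S X"
    using assms unfolding separable_def by blast
  interpret D: pair_fin_digraph D using D by (simp add: separates_def)
  define F where "F = \<lparr>pverts = pverts D \<times> (UNIV :: bool set),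
    parcs = {oriented b (d, i) (d', i') | d d' i i'. oriented b d d' \<in> parcs D \<and> (d' \<in> S \<longrightarrow> i)}\<rparr>"
  have sub: "parcs F \<subseteq> pverts F \<times> pverts F" and fin: "finite (pverts F)"
    using D.pair_finite_verts by (auto simp: F_def oriented_def D.in_arcsD1 D.in_arcsD2 split: if_splits)
  have hom: "is_hom fst F D" by (auto simp: is_hom_def F_def oriented_def split: if_splits)
  show ?thesis
  proof (rule separableI, rule separatesI)
    show "pair_fin_digraph F"
      by unfold_locales (use sub fin finite_subset[OF sub] in auto)
    show "f x \<in> {p. snd p}"
      if G: "pair_fin_digraph G" and f: "is_hom f G F" and "x \<in> pverts G"
        and x: "\<exists>y. oriented b x y \<in> parcs G \<and> X G y" for f G x
    proof -
      interpret G: pair_fin_digraph G by fact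
      obtain y where y: "oriented b x y \<in> parcs G" "X G y" using x by blast
      then have "fst (f y) \<in> S"
        using separatesD[OF D G is_hom_comp[OF f hom], of y] G.in_arcsD1 G.in_arcsD2
        by (auto simp: oriented_def split: if_splits)
      moreover have "oriented b (f x) (f y) \<in> parcs F"
        using f y by (auto simp: is_hom_def oriented_def)
      ultimately show ?thesis by (auto simp: F_def oriented_def split: if_splits)
    qed
    show "\<exists>c. is_hom c G F \<and> (\<forall>x\<in>pverts G. c x \<in> {p. snd p} \<longrightarrow> (\<exists>y. oriented b x y \<in> parcs G \<and> X G y))"
      if G: "pair_fin_digraph G" for G :: "nat pair_pre_digraph"
    proof -
      interpret G: pair_fin_digraph G by fact
      obtain c where "is_hom c G D" "\<forall>x\<in>pverts G. c x \<in> S \<longrightarrow> X G x"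
        using D G unfolding separates_def by blast
      then show ?thesis
        by (intro exI[of _ "\<lambda>x. (c x, \<exists>y. oriented b x y \<in> parcs G \<and> X G y)"])
          (cases b; auto simp: is_hom_def F_def oriented_def dest: G.in_arcsD1 G.in_arcsD2)
    qed
  qed
qed

text \<open>
  The constraints \<open>X\<close> let the induction remove a leaf: that the leaf can be mapped becomes part of the
  constraint on its neighbour. A single vertex with its constraint has the dual \<open>D - S\<close>.
\<close>

lemma grown_tree_constrained_dual:
  assumes "grown_tree V A" "\<And>v. v \<in> V \<Longrightarrow> separable (X v)"
  shows "\<exists>D :: nat pair_pre_digraph. pair_fin_digraph D \<and> (\<forall>G. pair_fin_digraph G \<longrightarrow>
    ((\<exists>f. is_hom f \<lparr>pverts = V, parcs = A\<rparr> G \<and> (\<forall>v\<in>V. X v G (f v))) \<longleftrightarrow> \<not> hom_to G D))"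
  using assms
proof (induction arbitrary: X rule: grown_tree.induct)
  case (root r)
  obtain D :: "nat pair_pre_digraph" and S where D: "separates D S (X r)"
    using root unfolding separable_def by blast
  interpret D: pair_fin_digraph D using D by (simp add: separates_def)
  define E where "E = \<lparr>pverts = pverts D - S, parcs = {e \<in> parcs D. fst e \<notin> S \<and> snd e \<notin> S}\<rparr>"
  have "pair_fin_digraph E"
    using D.pair_finite_verts D.pair_finite_arcs
    by unfold_locales (auto simp: E_def D.in_arcsD1 D.in_arcsD2)
  moreover have "(\<exists>f. is_hom f \<lparr>pverts = {r}, parcs = {}\<rparr> G \<and> (\<forall>v\<in>{r}. X v G (f v))) \<longleftrightarrow> \<not> hom_to G E"
    if G: "pair_fin_digraph G" for G
  proof -
    interpret G: pair_fin_digraph G by fact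
    have "(\<exists>f. is_hom f \<lparr>pverts = {r}, parcs = {}\<rparr> G \<and> (\<forall>v\<in>{r}. X v G (f v))) \<longleftrightarrow>
        (\<exists>x\<in>pverts G. X r G x)"
      by (auto simp: is_hom_def)
    also have "\<dots> \<longleftrightarrow> \<not> hom_to G E"
    proof (intro iffI notI)
      assume "\<exists>x\<in>pverts G. X r G x" and "hom_to G E"
      then obtain x f where x: "x \<in> pverts G" "X r G x" and f: "is_hom f G E"
        using hom_to_iff G by blast
      have "is_hom f G D" using f by (auto simp: is_hom_def E_def)
      then have "f x \<in> S" using D G x by (auto simp: separates_def)
      then show False using f x(1) by (auto simp: is_hom_def E_def)
    next
      assume no: "\<not> hom_to G E"
      \<comment> \<open>If no vertex satisfies \<open>X r\<close>, this \<open>c\<close> avoids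
        \<open>S\<close> and is a homomorphism to \<open>E\<close>.\<close>
      obtain c where c: "is_hom c G D" "\<forall>x\<in>pverts G. c x \<in> S \<longrightarrow> X r G x"
        using D G unfolding separates_def by blast
      show "\<exists>x\<in>pverts G. X r G x"
      proof (rule ccontr)
        assume "\<not> ?thesis"
        then have "is_hom c G E"
          using c by (auto simp: is_hom_def E_def dest: G.in_arcsD1 G.in_arcsD2)
        then show False using no hom_to_iff[OF G] by blast
      qed
    qed
    finally show ?thesis .
  qed
  ultimately show ?case by blast
next
  case (leaf V A u w b)
  note A = grown_tree_arcs[OF leaf.hyps(1)]
  let ?X = "\<lambda>v. if v = u then (\<lambda>G x. X u G x \<and> (\<exists>y. oriented b x y \<in> parcs G \<and> X w G y)) else X v"
  have sep: "separable (?X v)" if "v \<in> V" for v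
    using that leaf.prems leaf.hyps(2) separable_conj[OF _ separable_neighbour] by simp
  obtain D :: "nat pair_pre_digraph" where D: "pair_fin_digraph D"
    "\<And>G. pair_fin_digraph G \<Longrightarrow>
      (\<exists>f. is_hom f \<lparr>pverts = V, parcs = A\<rparr> G \<and> (\<forall>v\<in>V. ?X v G (f v))) \<longleftrightarrow> \<not> hom_to G D"
    using leaf.IH[of ?X, OF sep] by blast
  have "(\<exists>f. is_hom f \<lparr>pverts = insert w V, parcs = insert (oriented b u w) A\<rparr> G \<and> (\<forall>v\<in>insert w V. X v G (f v)))
      \<longleftrightarrow> (\<exists>f. is_hom f \<lparr>pverts = V, parcs = A\<rparr> G \<and> (\<forall>v\<in>V. ?X v G (f v)))"
    if G: "pair_fin_digraph G" for G
  proof -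
    interpret G: pair_fin_digraph G by fact
    show ?thesis
    proof
      assume "\<exists>f. is_hom f \<lparr>pverts = insert w V, parcs = insert (oriented b u w) A\<rparr> G \<and> (\<forall>v\<in>insert w V. X v G (f v))"
      then show "\<exists>f. is_hom f \<lparr>pverts = V, parcs = A\<rparr> G \<and> (\<forall>v\<in>V. ?X v G (f v))"
      proof (elim exE conjE)
        fix f assume f: "is_hom f \<lparr>pverts = insert w V, parcs = insert (oriented b u w) A\<rparr> G"
          "\<forall>v\<in>insert w V. X v G (f v)"
        then have "is_hom f \<lparr>pverts = V, parcs = A\<rparr> G" "oriented b (f u) (f w) \<in> parcs G"
          by (auto simp: is_hom_def oriented_def)
        then show ?thesis using f(2) by auto
      qed
    next
      assume "\<exists>f. is_hom f \<lparr>pverts = V, parcs = A\<rparr> G \<and> (\<forall>v\<in>V. ?X v G (f v))"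
      then obtain f where f: "is_hom f \<lparr>pverts = V, parcs = A\<rparr> G" "\<forall>v\<in>V. ?X v G (f v)" by blast
      then obtain y where y: "oriented b (f u) y \<in> parcs G" "X w G y" "X u G (f u)"
        using leaf.hyps(2) by fastforce
      \<comment> \<open>As \<open>w\<close> is new and the arcs of \<open>A\<close> stay inside
        \<open>V\<close>, changing the value at \<open>w\<close> affects only the new arc.\<close>
      have "is_hom (f(w := y)) \<lparr>pverts = insert w V, parcs = insert (oriented b u w) A\<rparr> G"
        using f(1) y(1) leaf.hyps(2,3) A G.in_arcsD1 G.in_arcsD2
        by (auto simp: is_hom_def oriented_def split: if_splits)
      moreover have "\<forall>v\<in>insert w V. X v G ((f(w := y)) v)"
        using f(2) y leaf.hyps(2,3) by (auto split: if_splits)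
      ultimately show "\<exists>f. is_hom f \<lparr>pverts = insert w V, parcs = insert (oriented b u w) A\<rparr> G \<and> (\<forall>v\<in>insert w V. X v G (f v))"
        by blast
    qed
  qed
  then show ?case using D by auto
qed

lemma oriented_tree_has_dual:
  assumes "oriented_tree T"
  obtains D :: "nat pair_pre_digraph" where "pair_fin_digraph D" "dual_pair T D"
proof -
  have T: "pair_fin_digraph T" using assms[unfolded oriented_tree_iff] by blast
  have "\<exists>D :: nat pair_pre_digraph. pair_fin_digraph D \<and>
      (\<forall>G :: nat pair_pre_digraph. pair_fin_digraph G \<longrightarrow> ((\<exists>f. is_hom f T G) \<longleftrightarrow> \<not> hom_to G D))"
    using grown_tree_constrained_dual[OF grown_tree_if_oriented_tree[OF assms],
      of "\<lambda>v G x. True"] separable_True by (simp add: is_hom_def)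
  then obtain D :: "nat pair_pre_digraph" where D: "pair_fin_digraph D"
    "\<forall>G :: nat pair_pre_digraph. pair_fin_digraph G \<longrightarrow> ((\<exists>f. is_hom f T G) \<longleftrightarrow> \<not> hom_to G D)"
    by blast
  then have "dual_pair T D"
    by (simp add: dual_pair_def hom_to_iff[OF T])
  then show thesis using that D(1) by blast
qed

section \<open>Digraphs with a dual\<close>

definition induced :: "'a pair_pre_digraph \<Rightarrow> 'a set \<Rightarrow> 'a pair_pre_digraph" where
  "induced G W = \<lparr>pverts = pverts G \<inter> W, parcs = parcs G \<inter> (W \<times> W)\<rparr>"

lemma pair_fin_digraph_induced:
  assumes "pair_fin_digraph G"
  shows "pair_fin_digraph (induced G W)"
proof -
  interpret G: pair_fin_digraph G by fact
  show ?thesis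
    using G.pair_finite_verts G.pair_finite_arcs
    by unfold_locales (auto simp: induced_def G.in_arcsD1 G.in_arcsD2)
qed

lemma is_hom_induced: "is_hom id (induced G W) G"
  by (auto simp: is_hom_def induced_def)

section \<open>Cores, as digraphs with the fewest vertices in their class\<close>

definition hom_minimal :: "nat pair_pre_digraph \<Rightarrow> bool" where
  "hom_minimal C \<longleftrightarrow> pair_fin_digraph C \<and>
     (\<forall>B :: nat pair_pre_digraph. pair_fin_digraph B \<longrightarrow> hom_equivalent C B \<longrightarrow> card (pverts C) \<le> card (pverts B))"

text \<open>An induced subdigraph maps back to \<open>C\<close> by inclusion, so it is equivalent to
  \<open>C\<close> and cannot have fewer vertices.\<close>

lemma hom_minimal_induced:
  assumes "hom_minimal C" "hom_to C (induced C W)"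
  shows "pverts C \<subseteq> W"
proof -
  have C: "pair_fin_digraph C" using assms(1) by (simp add: hom_minimal_def)
  then interpret C: pair_fin_digraph C .
  have I: "pair_fin_digraph (induced C W)" by (rule pair_fin_digraph_induced[OF C])
  have "hom_to (induced C W) C"
    using is_hom_induced hom_to_iff[OF I] by blast
  then have "card (pverts C) \<le> card (pverts (induced C W))"
    using assms I by (auto simp: hom_minimal_def hom_equivalent_def)
  then have "pverts C \<inter> W = pverts C"
    using C.pair_finite_verts by (intro card_seteq) (auto simp: induced_def)
  then show ?thesis by blast
qed

lemma hom_minimal_endo_surj:
  assumes "hom_minimal C" "is_hom f C C"
  shows "f ` pverts C = pverts C"
proof -
  have C: "pair_fin_digraph C" using assms(1) by (simp add: hom_minimal_def)
  then interpret C: pair_fin_digraph C .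
  have "is_hom f C (induced C (f ` pverts C))"
    using assms(2) C.in_arcsD1 C.in_arcsD2 by (auto simp: is_hom_def induced_def)
  then have "pverts C \<subseteq> f ` pverts C"
    using hom_minimal_induced[OF assms(1)] hom_to_iff[OF C] by blast
  then show ?thesis using assms(2) by (auto simp: is_hom_def)
qed

text \<open>An endomorphism is bijective on vertices by minimality, hence injective on arcs. As
  there are finitely many arcs it is also onto them, so its inverse preserves arcs.\<close>

lemma hom_minimal_endo_inverse:
  assumes "hom_minimal C" "is_hom f C C"
  obtains g where "is_hom g C C" "\<And>x. x \<in> pverts C \<Longrightarrow> f (g x) = x"
proof -
  interpret C: pair_fin_digraph C using assms(1) by (simp add: hom_minimal_def)
  have surj: "f ` pverts C = pverts C" by (rule hom_minimal_endo_surj[OF assms])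
  then have inj: "inj_on f (pverts C)" using C.pair_finite_verts by (simp add: finite_surj_inj)
  have "inj_on (map_prod f f) (parcs C)"
    using inj C.in_arcsD1 C.in_arcsD2 by (auto simp: inj_on_def)
  moreover have "map_prod f f ` parcs C \<subseteq> parcs C" using assms(2) by (auto simp: is_hom_def)
  ultimately have arcs: "map_prod f f ` parcs C = parcs C"
    using C.pair_finite_arcs endo_inj_surj by blast
  let ?g = "inv_into (pverts C) f"
  have "(?g x, ?g y) \<in> parcs C" if "(x, y) \<in> parcs C" for x y
  proof -
    have "(x, y) \<in> map_prod f f ` parcs C" using that arcs by simp
    then obtain x' y' where "(x', y') \<in> parcs C" "x = f x'" "y = f y'" by auto
    then show ?thesis using inj C.in_arcsD1 C.in_arcsD2 by simp
  qed
  then show thesis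
    using that[of ?g] surj by (auto simp: is_hom_def f_inv_into_f inv_into_into)
qed

text \<open>No arc joins the component \<open>W\<close> of \<open>u\<close> to its complement, so
  homomorphisms of both parts to \<open>D\<close> would glue to one of \<open>C\<close>. Hence one
  part does not map to \<open>D\<close>, and by duality \<open>C\<close> maps to it; minimality puts
  all of \<open>C\<close> there, and \<open>u\<close> shows that this part is
  \<open>W\<close>.\<close>

lemma dual_minimal_connected:
  assumes "hom_minimal C" "dual_pair C D" "u \<in> pverts C" "v \<in> pverts C"
  shows "(u, v) \<in> linked (parcs C)"
proof -
  have C: "pair_fin_digraph C" using assms(1) by (simp add: hom_minimal_def)
  then interpret C: pair_fin_digraph C .
  define W where "W = {x. (u, x) \<in> linked (parcs C)}"
  have closed: "x \<in> W \<and> y \<in> W \<or> x \<notin> W \<and> y \<notin> W" if "(x, y) \<in> parcs C" for x y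
  proof -
    have "(x, y) \<in> parcs C \<union> (parcs C)\<inverse>" "(y, x) \<in> parcs C \<union> (parcs C)\<inverse>" using that by auto
    then show ?thesis unfolding W_def by (blast intro: rtrancl_into_rtrancl)
  qed
  \<comment> \<open>Duality is tested on \<open>C\<close> itself, which maps to itself.\<close>
  have "\<not> hom_to C D" using assms(2) C hom_to_refl dual_pairD by blast
  moreover have "hom_to C D" if parts: "hom_to (induced C W) D" "hom_to (induced C (- W)) D"
  proof -
    obtain f g where "is_hom f (induced C W) D" "is_hom g (induced C (- W)) D"
      using parts hom_to_iff pair_fin_digraph_induced[OF C] by metis
    then have "is_hom (\<lambda>x. if x \<in> W then f x else g x) C D"
      unfolding is_hom_def induced_def using closed by fastforce
    then show ?thesis using hom_to_iff[OF C] by blast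
  qed
  ultimately have "hom_to C (induced C W) \<or> hom_to C (induced C (- W))"
    using dual_pairD[OF assms(2) C] pair_fin_digraph_induced[OF C] by blast
  then have "pverts C \<subseteq> W \<or> pverts C \<subseteq> - W"
    using hom_minimal_induced[OF assms(1)] by blast
  then show ?thesis using assms(3,4) by (auto simp: W_def)
qed

text \<open>
  If \<open>n\<close> is large, a homomorphism to \<open>D\<close> restricts in the same way to two of the copies, and the arc
  between these two makes the restriction a homomorphism of \<open>C\<close>.
\<close>

definition unfolding_at :: "'a pair_pre_digraph \<Rightarrow> 'a \<Rightarrow> 'a \<Rightarrow> nat \<Rightarrow> ('a \<times> nat) pair_pre_digraph" where
  "unfolding_at C a b n =
     \<lparr>pverts = pverts C \<times> {..<n},
      parcs = {((x, i), (y, i)) | x y i. (x, y) \<in> parcs C - {(a, b)} \<and> i < n} \<union>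
              {((a, i), (b, j)) | i j. i < j \<and> j < n}\<rparr>"

lemma pair_fin_digraph_unfolding_at:
  assumes "pair_fin_digraph C" "(a, b) \<in> parcs C"
  shows "pair_fin_digraph (unfolding_at C a b n)"
proof -
  interpret C: pair_fin_digraph C by fact
  let ?U = "unfolding_at C a b n"
  have sub: "parcs ?U \<subseteq> pverts ?U \<times> pverts ?U" and fin: "finite (pverts ?U)"
    using assms(2) C.pair_finite_verts by (auto simp: unfolding_at_def C.in_arcsD1 C.in_arcsD2)
  show ?thesis
    by unfold_locales (use sub fin finite_subset[OF sub] in auto)
qed

lemma unfolding_at_not_hom_to:
  assumes C: "pair_fin_digraph C" and D: "pair_fin_digraph D" and "\<not> hom_to C D"
  obtains n where "\<not> hom_to (unfolding_at C a b n) D"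
proof -
  interpret C: pair_fin_digraph C by fact
  interpret D: pair_fin_digraph D by fact
  let ?F = "pverts C \<rightarrow>\<^sub>E pverts D"
  \<comment> \<open>One copy more than there are extensional maps between the vertex sets, so two
    copies must carry the same restriction.\<close>
  let ?n = "Suc (card ?F)"
  have finF: "finite ?F" by (intro finite_PiE C.pair_finite_verts D.pair_finite_verts)
  have "\<not> is_hom h (unfolding_at C a b ?n) D" for h
  proof
    assume h: "is_hom h (unfolding_at C a b ?n) D"
    let ?r = "\<lambda>i. \<lambda>x\<in>pverts C. h (x, i)"
    have "?r ` {..<?n} \<subseteq> ?F" using h by (auto simp: is_hom_def unfolding_at_def)
    then have "card (?r ` {..<?n}) \<le> card ?F" by (rule card_mono[OF finF])
    then have "card (?r ` {..<?n}) < card {..<?n}" by simp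
    then have "\<not> inj_on ?r {..<?n}" by (rule pigeonhole)
    then obtain i j where ij: "i < j" "j < ?n" "?r i = ?r j"
      unfolding inj_on_def by (metis lessThan_iff linorder_neqE_nat)
    have eq: "h (x, j) = h (x, i)" if "x \<in> pverts C" for x
      using ij(3) that by (metis restrict_apply')
    have "is_hom (\<lambda>x. h (x, i)) C D"
      unfolding is_hom_def
    proof (intro conjI ballI allI impI)
      show "h (x, i) \<in> pverts D" if "x \<in> pverts C" for x
        using h ij that by (auto simp: is_hom_def unfolding_at_def)
      show "(h (x, i), h (y, i)) \<in> parcs D" if xy: "(x, y) \<in> parcs C" for x y
      proof (cases "(x, y) = (a, b)")
        case True
        then have "((x, i), (y, j)) \<in> parcs (unfolding_at C a b ?n)"
          using ij by (auto simp: unfolding_at_def)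
        then have "(h (x, i), h (y, j)) \<in> parcs D" using h unfolding is_hom_def by blast
        then show ?thesis using eq C.in_arcsD2[OF xy] by simp
      next
        case False
        then have "((x, i), (y, i)) \<in> parcs (unfolding_at C a b ?n)"
          using ij xy by (auto simp: unfolding_at_def)
        then show ?thesis using h unfolding is_hom_def by blast
      qed
    qed
    then show False using assms(3) hom_to_iff[OF C] by blast
  qed
  then have "\<not> hom_to (unfolding_at C a b ?n) D"
    using is_hom_if_homs unfolding hom_to_def by blast
  then show thesis by (rule that)
qed

text \<open>For a section of the projection to \<open>C\<close>, the index of the copy is constant
  along every arc other than \<open>(a, b)\<close> and strictly increases along
  \<open>(a, b)\<close>. A link between \<open>a\<close> and \<open>b\<close> avoiding this arc
  would make both indices equal.\<close>

lemma dual_minimal_bridge: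
  assumes "hom_minimal C" "dual_pair C D" "pair_fin_digraph D" "(a, b) \<in> parcs C"
  shows "(a, b) \<notin> linked (parcs C - {(a, b)})"
proof
  assume l: "(a, b) \<in> linked (parcs C - {(a, b)})"
  have C: "pair_fin_digraph C" using assms(1) by (simp add: hom_minimal_def)
  then interpret C: pair_fin_digraph C .
  have "\<not> hom_to C D" using assms(2) C hom_to_refl dual_pairD by blast
  then obtain n where n: "\<not> hom_to (unfolding_at C a b n) D"
    using unfolding_at_not_hom_to[OF C assms(3)] by blast
  let ?U = "unfolding_at C a b n"
  have "hom_to C ?U"
    using n dual_pairD[OF assms(2) C] pair_fin_digraph_unfolding_at[OF C assms(4)] by blast
  then obtain h where h: "is_hom h C ?U" using hom_to_iff[OF C] by blast
  have "is_hom fst ?U C" using assms(4) by (auto simp: is_hom_def unfolding_at_def)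
  then have "is_hom (fst \<circ> h) C C" by (rule is_hom_comp[OF h])
  \<comment> \<open>The endomorphism \<open>fst \<circ> h\<close> has a right inverse
    \<open>g\<close>, so \<open>h \<circ> g\<close> is a section of the projection.\<close>
  then obtain g where g: "is_hom g C C" "\<And>x. x \<in> pverts C \<Longrightarrow> (fst \<circ> h) (g x) = x"
    using hom_minimal_endo_inverse[OF assms(1)] by blast
  define level where "level x = snd (h (g x))" for x
  have hg: "h (g x) = (x, level x)" if "x \<in> pverts C" for x
    using g(2)[OF that] by (simp add: level_def prod_eq_iff)
  have arc: "((x, level x), (y, level y)) \<in> parcs ?U" if "(x, y) \<in> parcs C" for x y
  proof -
    have "(h (g x), h (g y)) \<in> parcs ?U" using that g(1) h by (auto simp: is_hom_def)
    then show ?thesis using hg C.in_arcsD1[OF that] C.in_arcsD2[OF that] by simp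
  qed
  have same: "level x = level y" if "(x, y) \<in> parcs C - {(a, b)}" for x y
    using that arc[of x y] by (auto simp: unfolding_at_def)
  have "level a = level b"
    using l
  proof (induction rule: rtrancl_induct)
    case (step y z)
    from step.hyps(2) have "(y, z) \<in> parcs C - {(a, b)} \<or> (z, y) \<in> parcs C - {(a, b)}" by blast
    then show ?case using same[of y z] same[of z y] step.IH by metis
  qed simp
  then show False using arc[OF assms(4)] by (auto simp: unfolding_at_def)
qed

text \<open>Duality depends only on the equivalence class, so it passes to a member with the fewest
  vertices, which is connected and has only bridges.\<close>

lemma hom_equivalent_to_tree_if_dual:
  fixes D :: "nat pair_pre_digraph"
  assumes P: "pair_fin_digraph P" and D: "pair_fin_digraph D" and dual: "dual_pair P D"
  shows "hom_equivalent_to_tree P"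
proof -
  let ?eq = "\<lambda>C :: nat pair_pre_digraph. pair_fin_digraph C \<and> hom_equivalent P C"
  obtain N :: "nat pair_pre_digraph" and f g
    where N: "pair_fin_digraph N" "is_hom f P N" "is_hom g N P"
    using nat_copy[OF P] by metis
  then have "?eq N" using P by (auto simp: hom_equivalent_def hom_to_iff)
  then obtain C where C: "?eq C" and min: "\<And>B. ?eq B \<Longrightarrow> card (pverts C) \<le> card (pverts B)"
    using ex_has_least_nat[of ?eq N "\<lambda>C. card (pverts C)"] by blast
  have "?eq B" if "pair_fin_digraph B" "hom_equivalent C B" for B
    using that C P hom_to_trans unfolding hom_equivalent_def by metis
  then have hm: "hom_minimal C" using C min by (simp add: hom_minimal_def)
  have dC: "dual_pair C D" using dual_pair_cong dual P C by blast
  \<comment> \<open>An empty \<open>C\<close> would map to \<open>D\<close>, and then by duality not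
    to itself.\<close>
  have "pverts C \<noteq> {}"
  proof
    assume "pverts C = {}"
    moreover interpret C: pair_fin_digraph C using C by blast
    have "parcs C = {}" using \<open>pverts C = {}\<close> C.in_arcsD1 by auto
    ultimately have "is_hom undefined C D" by (simp add: is_hom_def)
    then show False using C dC dual_pairD hom_to_refl hom_to_iff by metis
  qed
  then have "oriented_tree C"
    unfolding oriented_tree_iff
    using C dual_minimal_connected[OF hm dC] dual_minimal_bridge[OF hm dC D] by blast
  then show ?thesis using C unfolding hom_equivalent_to_tree_def by blast
qed

section \<open>Pultr functors\<close>

lemma pultr_identify_equiv:
  assumes "is_pultr_template \<T>" "pair_fin_digraph G" "(a, b) \<in> pultr_identify \<T> G"
  shows "pultr_equiv \<T> G `` {a} = pultr_equiv \<T> G `` {b}"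
proof (rule equiv_class_eq[OF equiv_pultr_equiv])
  interpret G: pair_fin_digraph G by fact
  show "(a, b) \<in> pultr_equiv \<T> G"
    using assms(1,3)
    by (auto simp: pultr_equiv_def pultr_identify_def pultr_copies_def is_pultr_template_def
        homs_def G.in_arcsD1 G.in_arcsD2 intro!: r_into_rtrancl)
qed

text \<open>The restriction to the copy of \<open>P\<close> at \<open>u\<close> is a vertex of
  \<Gamma>(H). The restriction to the copy of \<open>Q\<close> at an arc witnesses the corresponding
  arc, and the identifications provide the two required equations.\<close>

lemma hom_to_central_if_left_hom_to:
  assumes \<T>: "is_pultr_template \<T>" and G: "pair_fin_digraph G"
    and "hom_to (left_pultr \<T> G) H"
  shows "hom_to G (central_pultr \<T> H)"
proof -
  interpret G: pair_fin_digraph G by fact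
  interpret P: pair_fin_digraph "tmpl_P \<T>" using \<T> by (simp add: is_pultr_template_def)
  interpret Q: pair_fin_digraph "tmpl_Q \<T>" using \<T> by (simp add: is_pultr_template_def)
  let ?cls = "\<lambda>a. pultr_equiv \<T> G `` {a}"
  obtain g where g: "is_hom g (left_pultr \<T> G) H"
    using assms(3) is_hom_if_homs unfolding hom_to_def by blast
  have vert: "g (?cls a) \<in> pverts H" if "a \<in> pverts (pultr_copies \<T> G)" for a
    using g that by (auto simp: is_hom_def left_pultr_def intro: quotientI)
  have arc: "(g (?cls a), g (?cls b)) \<in> parcs H" if "(a, b) \<in> parcs (pultr_copies \<T> G)" for a b
  proof -
    have "(?cls a, ?cls b) \<in> parcs (left_pultr \<T> G)" using that by (auto simp: left_pultr_def)
    then show ?thesis using g unfolding is_hom_def by blast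
  qed
  define f where "f u = (\<lambda>x\<in>pverts (tmpl_P \<T>). g (?cls (PCopy u x)))" for u
  have "f u \<in> homs (tmpl_P \<T>) H" if "u \<in> pverts G" for u
    using that P.in_arcsD1 P.in_arcsD2
    by (auto simp: f_def homs_def pultr_copies_def intro!: vert arc)
  moreover have "(f u, f v) \<in> parcs (central_pultr \<T> H)" if uv: "(u, v) \<in> parcs G" for u v
  proof -
    define h where "h = (\<lambda>y\<in>pverts (tmpl_Q \<T>). g (?cls (QCopy u v y)))"
    have h: "h \<in> homs (tmpl_Q \<T>) H"
      using uv Q.in_arcsD1 Q.in_arcsD2
      by (auto simp: h_def homs_def pultr_copies_def intro!: vert arc)
    have eps: "tmpl_eps1 \<T> x \<in> pverts (tmpl_Q \<T>)" "tmpl_eps2 \<T> x \<in> pverts (tmpl_Q \<T>)"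
      "?cls (PCopy u x) = ?cls (QCopy u v (tmpl_eps1 \<T> x))"
      "?cls (PCopy v x) = ?cls (QCopy u v (tmpl_eps2 \<T> x))"
      if "x \<in> pverts (tmpl_P \<T>)" for x
      using that \<T> uv
      by (auto simp: is_pultr_template_def homs_def pultr_identify_def
          intro!: pultr_identify_equiv[OF \<T> G])
    have "f u = compose (pverts (tmpl_P \<T>)) h (tmpl_eps1 \<T>)"
      "f v = compose (pverts (tmpl_P \<T>)) h (tmpl_eps2 \<T>)"
      by (auto simp: f_def h_def compose_def eps intro!: restrict_ext)
    then show ?thesis using h by (auto simp: central_pultr_def)
  qed
  ultimately have "is_hom f G (central_pultr \<T> H)"
    by (auto simp: is_hom_def central_pultr_def)
  then show ?thesis using hom_to_iff[OF G] by blast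
qed

text \<open>Choose a witness on \<open>Q\<close> for each arc of \<open>G\<close>. The maps on the
  copies then agree on identified vertices, so together they descend to the quotient.\<close>

lemma left_hom_to_if_hom_to_central:
  assumes \<T>: "is_pultr_template \<T>" and G: "pair_fin_digraph G"
    and "hom_to G (central_pultr \<T> H)"
  shows "hom_to (left_pultr \<T> G) H"
proof -
  interpret G: pair_fin_digraph G by fact
  interpret P: pair_fin_digraph "tmpl_P \<T>" using \<T> by (simp add: is_pultr_template_def)
  interpret Q: pair_fin_digraph "tmpl_Q \<T>" using \<T> by (simp add: is_pultr_template_def)
  let ?copies = "pultr_copies \<T> G"
  let ?cls = "\<lambda>a. pultr_equiv \<T> G `` {a}"
  obtain f where f: "is_hom f G (central_pultr \<T> H)"
    using assms(3) hom_to_iff[OF G] by blast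
  then have fP: "f u \<in> homs (tmpl_P \<T>) H" if "u \<in> pverts G" for u
    using that by (auto simp: is_hom_def central_pultr_def)
  have "\<forall>e\<in>parcs G. \<exists>h. h \<in> homs (tmpl_Q \<T>) H \<and>
      f (fst e) = compose (pverts (tmpl_P \<T>)) h (tmpl_eps1 \<T>) \<and>
      f (snd e) = compose (pverts (tmpl_P \<T>)) h (tmpl_eps2 \<T>)"
    using f by (force simp: is_hom_def central_pultr_def)
  then obtain q where q: "\<And>u v. (u, v) \<in> parcs G \<Longrightarrow> q (u, v) \<in> homs (tmpl_Q \<T>) H"
    "\<And>u v. (u, v) \<in> parcs G \<Longrightarrow> f u = compose (pverts (tmpl_P \<T>)) (q (u, v)) (tmpl_eps1 \<T>)"
    "\<And>u v. (u, v) \<in> parcs G \<Longrightarrow> f v = compose (pverts (tmpl_P \<T>)) (q (u, v)) (tmpl_eps2 \<T>)"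
    by (metis fst_conv snd_conv)
  define k where "k a = (case a of PCopy u x \<Rightarrow> f u x | QCopy u v y \<Rightarrow> q (u, v) y)" for a
  have vert: "k a \<in> pverts H" if "a \<in> pverts ?copies" for a
    using that fP q(1) by (fastforce simp: k_def pultr_copies_def homs_def)
  have arc: "(k a, k b) \<in> parcs H" if "(a, b) \<in> parcs ?copies" for a b
    using that fP q(1) by (fastforce simp: k_def pultr_copies_def homs_def)
  have identify: "k a = k b" if "(a, b) \<in> pultr_identify \<T> G" for a b
  proof (cases rule: UnE[OF that[unfolded pultr_identify_def]])
    case 1
    then obtain u v x where "(u, v) \<in> parcs G" "x \<in> pverts (tmpl_P \<T>)"
      "a = PCopy u x" "b = QCopy u v (tmpl_eps1 \<T> x)" by blast
    then show ?thesis using q(2)[of u v] by (simp add: k_def compose_def)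
  next
    case 2
    then obtain u v x where "(u, v) \<in> parcs G" "x \<in> pverts (tmpl_P \<T>)"
      "a = PCopy v x" "b = QCopy u v (tmpl_eps2 \<T> x)" by blast
    then show ?thesis using q(3)[of u v] by (simp add: k_def compose_def)
  qed
  have equiv: "k a = k b" if "(a, b) \<in> pultr_equiv \<T> G" for a b
  proof -
    have "(a, b) \<in> (pultr_identify \<T> G \<union> (pultr_identify \<T> G)\<inverse>)\<^sup>*"
      using that by (simp add: pultr_equiv_def)
    then show ?thesis
    proof (induction rule: rtrancl_induct)
      case (step b c)
      then show ?case using identify[of b c] identify[of c b] by auto
    qed simp
  qed
  \<comment> \<open>The choice of the representative does not matter, since \<open>k\<close> is
    constant on classes.\<close>
  define K where "K c = k (SOME a. a \<in> c)" for c
  have K: "K (?cls a) = k a" if "a \<in> pverts ?copies" for a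
  proof -
    have "a \<in> ?cls a" using equiv_class_self[OF equiv_pultr_equiv that] .
    then have "(SOME b. b \<in> ?cls a) \<in> ?cls a" by (rule someI)
    then show ?thesis using equiv by (auto simp: K_def)
  qed
  have "is_hom K (left_pultr \<T> G) H"
    unfolding is_hom_def
  proof (intro conjI ballI allI impI)
    fix c assume "c \<in> pverts (left_pultr \<T> G)"
    then show "K c \<in> pverts H" using K vert by (auto simp: left_pultr_def elim: quotientE)
  next
    fix c d assume "(c, d) \<in> parcs (left_pultr \<T> G)"
    then obtain a b where ab: "(a, b) \<in> parcs ?copies" "c = ?cls a" "d = ?cls b"
      by (auto simp: left_pultr_def)
    then have "a \<in> pverts ?copies" "b \<in> pverts ?copies"
      by (auto simp: pultr_copies_def P.in_arcsD1 P.in_arcsD2 Q.in_arcsD1 Q.in_arcsD2)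
    then show "(K c, K d) \<in> parcs H" using ab K arc by simp
  qed
  then show ?thesis
    using hom_to_iff[OF pair_fin_digraph_left_pultr[OF \<T> G]] by blast
qed

lemma left_hom_to_iff:
  assumes "is_pultr_template \<T>" "pair_fin_digraph G"
  shows "hom_to (left_pultr \<T> G) H \<longleftrightarrow> hom_to G (central_pultr \<T> H)"
  using hom_to_central_if_left_hom_to[OF assms] left_hom_to_if_hom_to_central[OF assms] by blast

section \<open>Duals obtained from the right adjoint\<close>

lemma dual_pair_left_pultr:
  assumes \<T>: "is_pultr_template \<T>" and \<Omega>: "is_right_adjoint_of_central \<T> \<Omega>"
    and T: "pair_fin_digraph T" and D: "pair_fin_digraph D" and dual: "dual_pair T D"
  shows "dual_pair (left_pultr \<T> T) (\<Omega> D)"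
  unfolding dual_pair_def
proof (intro allI impI)
  fix G :: "nat pair_pre_digraph"
  assume G: "pair_fin_digraph G"
  have "hom_to (left_pultr \<T> T) G \<longleftrightarrow> hom_to T (central_pultr \<T> G)"
    by (rule left_hom_to_iff[OF \<T> T])
  also have "\<dots> \<longleftrightarrow> \<not> hom_to (central_pultr \<T> G) D"
    by (rule dual_pairD[OF dual T pair_fin_digraph_central_pultr[OF \<T> G]])
  also have "\<dots> \<longleftrightarrow> \<not> hom_to G (\<Omega> D)"
    using \<Omega> G D by (simp add: is_right_adjoint_of_central_def)
  finally show "hom_to (left_pultr \<T> T) G \<longleftrightarrow> \<not> hom_to G (\<Omega> D)" .
qed

text \<open>This is read off \<Gamma>(G) directly: its vertices are the homomorphisms from
  \<open>P\<close> to \<open>G\<close>, and a digraph maps to the empty one exactly if it has no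
  vertex.\<close>

lemma dual_pair_tmpl_P:
  assumes \<T>: "is_pultr_template \<T>" and \<Omega>: "is_right_adjoint_of_central \<T> \<Omega>"
  shows "dual_pair (tmpl_P \<T>) (\<Omega> \<lparr>pverts = {}, parcs = {}\<rparr>)"
  unfolding dual_pair_def
proof (intro allI impI)
  fix G :: "nat pair_pre_digraph"
  let ?E = "\<lparr>pverts = {}, parcs = {}\<rparr> :: nat pair_pre_digraph"
  assume G: "pair_fin_digraph G"
  interpret \<Gamma>: pair_fin_digraph "central_pultr \<T> G" by (rule pair_fin_digraph_central_pultr[OF \<T> G])
  have E: "pair_fin_digraph ?E" by unfold_locales auto
  have "hom_to (tmpl_P \<T>) G \<longleftrightarrow> pverts (central_pultr \<T> G) \<noteq> {}"
    by (auto simp: hom_to_def central_pultr_def)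
  also have "\<dots> \<longleftrightarrow> \<not> hom_to (central_pultr \<T> G) ?E"
    using \<Gamma>.in_arcsD1 by (auto simp: hom_to_iff[OF \<Gamma>.pair_fin_digraph_axioms] is_hom_def)
  also have "\<dots> \<longleftrightarrow> \<not> hom_to G (\<Omega> ?E)"
    using \<Omega> G E by (simp add: is_right_adjoint_of_central_def)
  finally show "hom_to (tmpl_P \<T>) G \<longleftrightarrow> \<not> hom_to G (\<Omega> ?E)" .
qed

text \<open>Each homomorphism from \<open>Q\<close> to \<open>G\<close> yields an arc of
  \<Gamma>(G), and every arc arises so. A digraph maps to a single vertex without a loop exactly if
  it has no arc.\<close>

lemma dual_pair_tmpl_Q:
  assumes \<T>: "is_pultr_template \<T>" and \<Omega>: "is_right_adjoint_of_central \<T> \<Omega>"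
  shows "dual_pair (tmpl_Q \<T>) (\<Omega> \<lparr>pverts = {0}, parcs = {}\<rparr>)"
  unfolding dual_pair_def
proof (intro allI impI)
  fix G :: "nat pair_pre_digraph"
  let ?E = "\<lparr>pverts = {0}, parcs = {}\<rparr> :: nat pair_pre_digraph"
  assume G: "pair_fin_digraph G"
  interpret \<Gamma>: pair_fin_digraph "central_pultr \<T> G" by (rule pair_fin_digraph_central_pultr[OF \<T> G])
  have E: "pair_fin_digraph ?E" by unfold_locales auto
  have "hom_to (tmpl_Q \<T>) G \<longleftrightarrow> parcs (central_pultr \<T> G) \<noteq> {}"
    by (auto simp: hom_to_def central_pultr_def)
  also have "\<dots> \<longleftrightarrow> \<not> hom_to (central_pultr \<T> G) ?E"
    by (auto simp: hom_to_iff[OF \<Gamma>.pair_fin_digraph_axioms] is_hom_def)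
  also have "\<dots> \<longleftrightarrow> \<not> hom_to G (\<Omega> ?E)"
    using \<Omega> G E by (simp add: is_right_adjoint_of_central_def)
  finally show "hom_to (tmpl_Q \<T>) G \<longleftrightarrow> \<not> hom_to G (\<Omega> ?E)" .
qed

theorem theorem2p5:
  fixes \<T> :: "('p, 'q) pultr_template"
  assumes "is_pultr_template \<T>"
    and "\<exists>\<Omega>. is_right_adjoint_of_central \<T> \<Omega>"
  shows "hom_equivalent_to_tree (tmpl_P \<T>) \<and> hom_equivalent_to_tree (tmpl_Q \<T>) \<and>
    (\<forall>T :: 'a pair_pre_digraph. oriented_tree T \<longrightarrow> hom_equivalent_to_tree (left_pultr \<T> T))"
proof -
  note \<T> = assms(1)
  obtain \<Omega> where \<Omega>: "is_right_adjoint_of_central \<T> \<Omega>" using assms(2) by blast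
  have fin: "pair_fin_digraph (\<Omega> D)" if "pair_fin_digraph D" for D
    using \<Omega> that by (simp add: is_right_adjoint_of_central_def digraph_functor_def)
  have P: "pair_fin_digraph (tmpl_P \<T>)" and Q: "pair_fin_digraph (tmpl_Q \<T>)"
    using \<T> by (simp_all add: is_pultr_template_def)
  have "pair_fin_digraph \<lparr>pverts = {} :: nat set, parcs = {}\<rparr>" by unfold_locales auto
  then have "hom_equivalent_to_tree (tmpl_P \<T>)"
    using hom_equivalent_to_tree_if_dual[OF P fin dual_pair_tmpl_P[OF \<T> \<Omega>]] by blast
  moreover have "pair_fin_digraph \<lparr>pverts = {0 :: nat}, parcs = {}\<rparr>" by unfold_locales auto
  then have "hom_equivalent_to_tree (tmpl_Q \<T>)"
    using hom_equivalent_to_tree_if_dual[OF Q fin dual_pair_tmpl_Q[OF \<T> \<Omega>]] by blast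
  moreover have "hom_equivalent_to_tree (left_pultr \<T> T)"
    if tree: "oriented_tree T" for T :: "'a pair_pre_digraph"
  proof -
    have T: "pair_fin_digraph T" using tree[unfolded oriented_tree_iff] by blast
    \<comment> \<open>The dual is taken on \<open>nat\<close>, where \<open>\<Omega>\<close>
      acts.\<close>
    obtain D :: "nat pair_pre_digraph" where D: "pair_fin_digraph D" "dual_pair T D"
      by (rule oriented_tree_has_dual[OF tree])
    show ?thesis
      using hom_equivalent_to_tree_if_dual[OF pair_fin_digraph_left_pultr[OF \<T> T] fin[OF D(1)]]
        dual_pair_left_pultr[OF \<T> \<Omega> T D] by blast
  qed
  ultimately show ?thesis by blast
qed

end
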